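(* Suppose $R:[0,\infty)\to[0,\infty)$ is measurable, nondecreasing, strictly concave, $R(0)=0$, twice continuously differentiable on $(0,\infty)$, with derivative $R_c$ satisfying $\lim_{C\to0}R_c(C)=\infty$ and $\lim_{C\to\infty}R_c(C)=0$; and suppose $G(C)=G_0+\frac{c_-}{f_C}C$ for some $G_0\ge0$. Then the value function $(t,y)\mapsto v(t,y)$ of the zero-sum optimal stopping game is continuous on $[0,T]\times(0,\infty)$.
   Context: Constants: $T>0$, $\mu_C,\sigma_C,f_C,\mu_F>0$, $c_+>c_->0$; $\bar\mu:=\mu_C+\mu_F$, $\hat\mu_C:=-\mu_C+\frac12\sigma_C^2$. $(\Omega,\mathcal F,\mathbb P)$ is a complete probability space with a Brownian motion $W$ and its augmented natural filtration $\mathbb F=\{\mathcal F_t\}$. The measure $\tilde{\mathbb P}$ (expectation $\tilde{\mathbb E}$) is defined by $d\tilde{\mathbb P}/d\mathbb P|_{\mathcal F_t}=\exp\{-\frac12\sigma_C^2t+\sigma_CW(t)\}$, so $\tilde W(t)=W(t)-\sigma_Ct$ is a $\tilde{\mathbb P}$-Brownian motion, and $C^0(t)=\exp\{\hat\mu_Ct+\sigma_C\tilde W(t)\}$. For $(t,y)\in[0,T]\times(0,\infty)$ and $\mathbb F$-stopping times $\sigma,\tau$ with values in $[0,T-t]$ set $$\Psi(t,y;\sigma,\tau)=\tilde{\mathbb E}\Big\{\tfrac{c_+}{f_C}e^{-\bar\mu\sigma}\mathbf 1_{\{\sigma\le\tau\}}\mathbf 1_{\{\sigma<T-t\}}+\tfrac{c_-}{f_C}e^{-\bar\mu\tau}\mathbf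 1_{\{\tau<\sigma\}}+e^{-\bar\mu(T-t)}G_c(yC^0(T-t))\mathbf 1_{\{\tau=\sigma=T-t\}}+\int_0^{\tau\wedge\sigma}e^{-\bar\mu s}R_c(yC^0(s))ds\Big\},$$ where $G_c=G'$ (here $G_c\equiv c_-/f_C$). The value of the game is $$v(t,y)=\inf_{\sigma\in[0,T-t]}\sup_{\tau\in[0,T-t]}\Psi(t,y;\sigma,\tau)=\sup_{\tau\in[0,T-t]}\inf_{\sigma\in[0,T-t]}\Psi(t,y;\sigma,\tau),$$ the infimum and supremum being over stopping times with values in $[0,T-t]$ (the game has a value). *)

theory Defs
  imports "HOL-Probability.Probability"
begin

definition strictly_concave_on :: "real set \<Rightarrow> (real \<Rightarrow> real) \<Rightarrow> bool" where
  "strictly_concave_on S f \<longleftrightarrow> convex S \<and>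
     (\<forall>x\<in>S. \<forall>y\<in>S. \<forall>u. x \<noteq> y \<longrightarrow> 0 < u \<longrightarrow> u < 1 \<longrightarrow>
        (1 - u) * f x + u * f y < f ((1 - u) * x + u * y))"

text \<open>Processes are indexed by all of \<^typ>\<open>real\<close>; only times \<open>t \<ge> 0\<close> are ever used.\<close>

definition natural_filtration :: "'a measure \<Rightarrow> (real \<Rightarrow> 'a \<Rightarrow> real) \<Rightarrow> real \<Rightarrow> 'a measure" where
  "natural_filtration M W t =
     sigma (space M) {W s -` B \<inter> space M | s B. s \<in> {0..t} \<and> B \<in> sets borel}"

definition augmented_filtration :: "'a measure \<Rightarrow> (real \<Rightarrow> 'a \<Rightarrow> real) \<Rightarrow> real \<Rightarrow> 'a measure" where
  "augmented_filtration M W t =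
     sigma (space M) (sets (natural_filtration M W t) \<union> null_sets M)"

definition brownian_motion :: "'a measure \<Rightarrow> (real \<Rightarrow> 'a \<Rightarrow> real) \<Rightarrow> bool" where
  "brownian_motion M W \<longleftrightarrow>
     prob_space M \<and>
     (\<forall>t\<ge>0. W t \<in> borel_measurable M) \<and>
     (AE \<omega> in M. W 0 \<omega> = 0) \<and>
     (AE \<omega> in M. continuous_on {0..} (\<lambda>t. W t \<omega>)) \<and>
     (\<forall>s t. 0 \<le> s \<and> s < t \<longrightarrow>
        distributed M lborel (\<lambda>\<omega>. W t \<omega> - W s \<omega>) (normal_density 0 (sqrt (t - s)))) \<and>
     (\<forall>s t. 0 \<le> s \<and> s < t \<longrightarrow>
        prob_space.indep_set M
          (sets (vimage_algebra (space M) (\<lambda>\<omega>. W t \<omega> - W s \<omega>) borel))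
          (sets (natural_filtration M W s)))"

text \<open>
  \<open>Q\<close> is a measure on the same measurable space whose restriction to the time-\<open>t\<close> \<open>\<sigma>\<close>-algebra has
  density \<open>exp (- \<sigma>\<^sup>2 t / 2 + \<sigma> W t)\<close> for all \<open>t \<in> [0,T]\<close>. The horizon must be finite: the augmented
  filtration contains all null sets of \<open>M\<close> from time \<open>0\<close> on, so no such \<open>Q\<close> exists over \<open>[0,\<infinity>)\<close>.
  Beyond the time-\<open>T\<close> \<open>\<sigma>\<close>-algebra \<open>Q\<close> is unconstrained.
\<close>

definition tilde_measure ::
  "'a measure \<Rightarrow> (real \<Rightarrow> 'a \<Rightarrow> real) \<Rightarrow> real \<Rightarrow> real \<Rightarrow> 'a measure \<Rightarrow> bool" where
  "tilde_measure M W T sigC Q \<longleftrightarrow>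
     prob_space Q \<and> space Q = space M \<and> sets Q = sets M \<and>
     (\<forall>t\<in>{0..T}.
        restr_to_subalg Q (augmented_filtration M W t) =
        density (restr_to_subalg M (augmented_filtration M W t))
          (\<lambda>\<omega>. ennreal (exp (- (1/2) * sigC\<^sup>2 * t + sigC * W t \<omega>))))"

definition C0 :: "(real \<Rightarrow> 'a \<Rightarrow> real) \<Rightarrow> real \<Rightarrow> real \<Rightarrow> real \<Rightarrow> 'a \<Rightarrow> real" where
  "C0 W muC sigC t \<omega> =
     (let muhat = - muC + (1/2) * sigC\<^sup>2; Wtilde = W t \<omega> - sigC * t
      in exp (muhat * t + sigC * Wtilde))"

definition stopping_times :: "'a measure \<Rightarrow> (real \<Rightarrow> 'a \<Rightarrow> real) \<Rightarrow> real \<Rightarrow> ('a \<Rightarrow> real) set" where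
  "stopping_times M W h =
     {\<tau>. stopping_time (augmented_filtration M W) \<tau> \<and> (\<forall>\<omega>\<in>space M. \<tau> \<omega> \<in> {0..h})}"

text \<open>
  \<open>\<sigma>\<close> is the stopping time of the minimiser, \<open>\<tau>\<close> that of the maximiser; \<open>cp\<close>, \<open>cm\<close> are
  \<open>c\<^sub>+\<close>, \<open>c\<^sub>-\<close>, and \<open>Rc\<close>, \<open>Gc\<close> the marginal running and terminal payoffs.
\<close>

definition Psi ::
  "'a measure \<Rightarrow> (real \<Rightarrow> 'a \<Rightarrow> real) \<Rightarrow> real \<Rightarrow> real \<Rightarrow> real \<Rightarrow> real \<Rightarrow> real \<Rightarrow> real \<Rightarrow> real \<Rightarrow>
   (real \<Rightarrow> real) \<Rightarrow> (real \<Rightarrow> real) \<Rightarrow> real \<Rightarrow> real \<Rightarrow> ('a \<Rightarrow> real) \<Rightarrow> ('a \<Rightarrow> real) \<Rightarrow> real" where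
  "Psi Q W T muC sigC fC muF cp cm Rc Gc t y \<sigma> \<tau> =
     (let mubar = muC + muF in
      \<integral>\<omega>. cp / fC * exp (- mubar * \<sigma> \<omega>) * of_bool (\<sigma> \<omega> \<le> \<tau> \<omega>) * of_bool (\<sigma> \<omega> < T - t)
         + cm / fC * exp (- mubar * \<tau> \<omega>) * of_bool (\<tau> \<omega> < \<sigma> \<omega>)
         + exp (- mubar * (T - t)) * Gc (y * C0 W muC sigC (T - t) \<omega>)
             * of_bool (\<tau> \<omega> = T - t \<and> \<sigma> \<omega> = T - t)
         + (LBINT s:{0..min (\<tau> \<omega>) (\<sigma> \<omega>)}. exp (- mubar * s) * Rc (y * C0 W muC sigC s \<omega>))
      \<partial>Q)"

text \<open>
  The game has a value, so both functions below equal the value function \<open>v\<close>. Infima and suprema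
  are taken in the reals; under the standing assumptions \<^const>\<open>Psi\<close> is nonnegative and, for
  each \<open>y > 0\<close>, bounded uniformly in \<open>t\<close>, \<open>\<sigma>\<close>, \<open>\<tau>\<close>.
\<close>

definition upper_value ::
  "'a measure \<Rightarrow> 'a measure \<Rightarrow> (real \<Rightarrow> 'a \<Rightarrow> real) \<Rightarrow> real \<Rightarrow> real \<Rightarrow> real \<Rightarrow> real \<Rightarrow> real \<Rightarrow> real \<Rightarrow> real \<Rightarrow>
   (real \<Rightarrow> real) \<Rightarrow> (real \<Rightarrow> real) \<Rightarrow> real \<Rightarrow> real \<Rightarrow> real" where
  "upper_value M Q W T muC sigC fC muF cp cm Rc Gc t y =
     (INF \<sigma>\<in>stopping_times M W (T - t). SUP \<tau>\<in>stopping_times M W (T - t).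
        Psi Q W T muC sigC fC muF cp cm Rc Gc t y \<sigma> \<tau>)"

definition lower_value ::
  "'a measure \<Rightarrow> 'a measure \<Rightarrow> (real \<Rightarrow> 'a \<Rightarrow> real) \<Rightarrow> real \<Rightarrow> real \<Rightarrow> real \<Rightarrow> real \<Rightarrow> real \<Rightarrow> real \<Rightarrow> real \<Rightarrow>
   (real \<Rightarrow> real) \<Rightarrow> (real \<Rightarrow> real) \<Rightarrow> real \<Rightarrow> real \<Rightarrow> real" where
  "lower_value M Q W T muC sigC fC muF cp cm Rc Gc t y =
     (SUP \<tau>\<in>stopping_times M W (T - t). INF \<sigma>\<in>stopping_times M W (T - t).
        Psi Q W T muC sigC fC muF cp cm Rc Gc t y \<sigma> \<tau>)"

end

theory Submission
  imports Defs
begin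

text \<open>
  Write \<open>h = T - t\<close> for the remaining time. Since \<open>G\<close> is affine with slope \<open>c\<^sub>- / f\<^sub>C\<close>, the terminal
  reward is what the maximiser would get for stopping at the horizon, so the payoff is \<open>payoff\<close>: the
  discounted amount \<open>c\<^sub>+ / f\<^sub>C\<close> if the minimiser stops no later than the maximiser and strictly before \<open>h\<close>, the
  discounted amount \<open>c\<^sub>- / f\<^sub>C\<close> otherwise, and the running reward up to the first stop. The horizon thus enters the
  payoff discontinuously, and continuity of the value in \<open>t\<close> cannot come from continuity of the payoff
  for fixed strategies.

  Instead, strategies are translated between games, path by path. When the horizon grows from \<open>h\<close> to
  \<open>h'\<close>, the minimiser postpones a stop at \<open>h\<close> to \<open>h'\<close> and loses at most the running reward on
  \<open>[h,h']\<close> (\<open>payoff_lengthen\<close>). When it shrinks, he truncates his stopping time and loses nothing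
  (\<open>payoff_shorten\<close>). When only the state changes, he changes nothing, and the loss is the difference
  of the running rewards (\<open>payoff_change_reward\<close>). Such translations compare both the upper and the
  lower value (\<open>INF_SUP_transfer\<close>, \<open>SUP_INF_transfer\<close>), which gives the modulus of continuity
  \<open>\<bar>v(t,y) - v(t\<^sub>0,y\<^sub>0)\<bar> \<le> \<bar>\<Phi> y - \<Phi> y\<^sub>0\<bar> + L y\<^sub>0 \<bar>t - t\<^sub>0\<bar>\<close>,
  where \<open>\<Phi> y\<close> is the mean total running reward up to \<open>T\<close> and \<open>L y\<close> bounds the mean reward rate
  (\<open>value_modulus\<close>).

  That \<open>L\<close> and \<open>\<Phi>\<close> are finite follows from concavity: \<open>R'(x) \<le> R'(1) + R(1) / x\<close>
  (\<open>concave_deriv_bounds\<close>), and \<open>1 / C\<^sup>0(s)\<close> has mean \<open>exp (\<mu>\<^sub>C s)\<close> because \<open>C\<^sup>0(s)\<close> is \<open>exp (- \<mu>\<^sub>C s)\<close>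
  times the density of the changed measure (\<open>nn_integral_inverse_C0\<close>). Continuity of \<open>\<Phi>\<close> is dominated
  convergence, as \<open>R'\<close> is decreasing and continuous.
\<close>

section \<open>Carrying strategies from one zero-sum game to another\<close>

text \<open>
  A player who knows a good strategy in one game can use it in another if strategies can be
  translated: the minimiser's move \<open>a\<close> of the first game becomes \<open>f a\<close> in the second, and the opponent's
  reply \<open>b\<close> there is read back as \<open>g b\<close>. If the translated play costs at most \<open>e\<close> more, the upper value
  rises by at most \<open>e\<close>.
\<close>
lemma INF_SUP_transfer:
  fixes J :: "'a \<Rightarrow> 'b \<Rightarrow> real" and J' :: "'c \<Rightarrow> 'd \<Rightarrow> real"
  assumes ne: "A \<noteq> {}" "B' \<noteq> {}"
    and f: "\<And>a. a \<in> A \<Longrightarrow> f a \<in> A'" and g: "\<And>b. b \<in> B' \<Longrightarrow> g b \<in> B"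
    and le: "\<And>a b. a \<in> A \<Longrightarrow> b \<in> B' \<Longrightarrow> J' (f a) b \<le> J a (g b) + e"
    and upper: "\<And>a b. a \<in> A \<Longrightarrow> b \<in> B \<Longrightarrow> J a b \<le> K"
    and upper': "\<And>a b. a \<in> A' \<Longrightarrow> b \<in> B' \<Longrightarrow> J' a b \<le> K'"
    and lower': "\<And>a b. a \<in> A' \<Longrightarrow> b \<in> B' \<Longrightarrow> 0 \<le> J' a b"
  shows "(INF a\<in>A'. SUP b\<in>B'. J' a b) \<le> (INF a\<in>A. SUP b\<in>B. J a b) + e"
proof -
  obtain b0 where b0: "b0 \<in> B'" using ne by auto
  have bddA': "bdd_above (J' a ` B')" if "a \<in> A'" for a
    using upper'[OF that] by (auto intro!: bdd_aboveI2)
  have "0 \<le> (SUP b\<in>B'. J' a b)" if "a \<in> A'" for a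
    using cSUP_upper2[OF bddA'[OF that] b0 lower'[OF that b0]] .
  then have bdd: "bdd_below ((\<lambda>a. SUP b\<in>B'. J' a b) ` A')"
    by (rule bdd_belowI2)
  have "(INF a\<in>A'. SUP b\<in>B'. J' a b) - e \<le> (SUP b\<in>B. J a b)" if a: "a \<in> A" for a
  proof -
    have "(INF a\<in>A'. SUP b\<in>B'. J' a b) \<le> (SUP b\<in>B'. J' (f a) b)"
      by (rule cINF_lower[OF bdd f[OF a]])
    also have "\<dots> \<le> (SUP b\<in>B. J a b) + e"
    proof (rule cSUP_least[OF ne(2)])
      fix b assume b: "b \<in> B'"
      have "J a (g b) \<le> (SUP b\<in>B. J a b)"
        using upper[OF a] by (intro cSUP_upper g b bdd_aboveI2)
      with le[OF a b] show "J' (f a) b \<le> (SUP b\<in>B. J a b) + e" by simp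
    qed
    finally show ?thesis by simp
  qed
  then have "(INF a\<in>A'. SUP b\<in>B'. J' a b) - e \<le> (INF a\<in>A. SUP b\<in>B. J a b)"
    by (rule cINF_greatest[OF ne(1)])
  then show ?thesis by simp
qed

text \<open>
  The same pair of translations compares the lower values, because neither of them looks at the
  opponent's move.
\<close>
lemma SUP_INF_transfer:
  fixes J :: "'a \<Rightarrow> 'b \<Rightarrow> real" and J' :: "'c \<Rightarrow> 'd \<Rightarrow> real"
  assumes ne: "A \<noteq> {}" "B' \<noteq> {}"
    and f: "\<And>a. a \<in> A \<Longrightarrow> f a \<in> A'" and g: "\<And>b. b \<in> B' \<Longrightarrow> g b \<in> B"
    and le: "\<And>a b. a \<in> A \<Longrightarrow> b \<in> B' \<Longrightarrow> J' (f a) b \<le> J a (g b) + e"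
    and upper: "\<And>a b. a \<in> A \<Longrightarrow> b \<in> B \<Longrightarrow> J a b \<le> K"
    and lower: "\<And>a b. a \<in> A \<Longrightarrow> b \<in> B \<Longrightarrow> 0 \<le> J a b"
    and lower': "\<And>a b. a \<in> A' \<Longrightarrow> b \<in> B' \<Longrightarrow> 0 \<le> J' a b"
  shows "(SUP b\<in>B'. INF a\<in>A'. J' a b) \<le> (SUP b\<in>B. INF a\<in>A. J a b) + e"
proof (rule cSUP_least[OF ne(2)])
  fix b assume b: "b \<in> B'"
  obtain a0 where a0: "a0 \<in> A" using ne by auto
  have bddA: "bdd_below ((\<lambda>a. J a b) ` A)" if "b \<in> B" for b
    using lower that by (auto intro!: bdd_belowI2)
  have "(INF a\<in>A. J a b) \<le> K" if "b \<in> B" for b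
    using cINF_lower2[OF bddA[OF that] a0 upper[OF a0 that]] .
  then have bdd: "bdd_above ((\<lambda>b. INF a\<in>A. J a b) ` B)"
    by (rule bdd_aboveI2)
  have "(INF a\<in>A'. J' a b) - e \<le> J a (g b)" if a: "a \<in> A" for a
  proof -
    have "(INF a\<in>A'. J' a b) \<le> J' (f a) b"
      using lower' b by (intro cINF_lower f a bdd_belowI2)
    with le[OF a b] show ?thesis by simp
  qed
  then have "(INF a\<in>A'. J' a b) - e \<le> (INF a\<in>A. J a (g b))"
    by (rule cINF_greatest[OF ne(1)])
  also have "\<dots> \<le> (SUP b\<in>B. INF a\<in>A. J a b)"
    by (rule cSUP_upper[OF g[OF b] bdd])
  finally show "(INF a\<in>A'. J' a b) \<le> (SUP b\<in>B. INF a\<in>A. J a b) + e" by simp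
qed

section \<open>The payoff along a single path\<close>

text \<open>
  The game with horizon \<open>h\<close> along one path, when the minimiser stops at \<open>s\<close> and the maximiser at
  \<open>t\<close>. The terminal reward equals \<open>b exp (- m h)\<close>, which is what the maximiser would get for
  stopping at \<open>h\<close>; so the two lump sums at and before the horizon merge into one case distinction.
  Stopping by the minimiser counts only strictly before \<open>h\<close>, where it costs the larger amount \<open>a\<close>.
\<close>
definition payoff ::
  "real \<Rightarrow> real \<Rightarrow> real \<Rightarrow> real \<Rightarrow> (real \<Rightarrow> real) \<Rightarrow> real \<Rightarrow> real \<Rightarrow> real" where
  "payoff a b m h r s t =
     (if s \<le> t \<and> s < h then a * exp (- m * s) else b * exp (- m * t))
       + (LBINT u:{0..min t s}. r u)"

text \<open>
  The right-hand side of the equation absorbs the terminal lump sum: if both players stop at \<open>h\<close>,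
  only the third term on the left survives, and it is the amount \<open>b\<close> discounted from \<open>h = t\<close>.
\<close>
lemma payoff_alt:
  assumes "0 \<le> s" "s \<le> h" "0 \<le> t" "t \<le> h"
  shows "a * exp (- m * s) * of_bool (s \<le> t) * of_bool (s < h) + b * exp (- m * t) * of_bool (t < s)
      + exp (- m * h) * b * of_bool (t = h \<and> s = h) + (LBINT u:{0..min t s}. r u) =
    payoff a b m h r s t"
  using assms by (auto simp: payoff_def of_bool_def)

text \<open>
  If the horizon grows from \<open>h\<close> to \<open>h'\<close>, the minimiser keeps a stop before \<open>h\<close> and postpones a stop
  at \<open>h\<close> to \<open>h'\<close>. Then he never pays the cost \<open>a\<close> where he did not pay it before, and discounting
  only lowers the amount \<open>b\<close> that a later maximiser receives; what remains is the running reward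
  collected between \<open>h\<close> and \<open>h'\<close>. Simply keeping the stop at \<open>h\<close> would cost him the jump
  \<open>a - b\<close>.
\<close>
lemma payoff_lengthen:
  assumes r: "set_integrable lborel {0..T} r" "\<And>u. 0 \<le> r u"
    and "0 \<le> b" "0 \<le> m" "0 \<le> s" "s \<le> h" "h \<le> h'" "h' \<le> T" "0 \<le> t" "t \<le> h'"
  shows "payoff a b m h' r (if s < h then s else h') t
           \<le> payoff a b m h r s (min t h) + (LBINT u:{h..h'}. r u)"
proof (cases "s < h")
  case True
  have "0 \<le> (LBINT u:{h..h'}. r u)"
    unfolding set_lebesgue_integral_def by (intro integral_nonneg_AE) (simp add: r)
  with True show ?thesis
    using assms by (auto simp: payoff_def min_def)
next
  case False
  have int: "integrable lborel (\<lambda>u. indicator {c..d} u *\<^sub>R r u)" if "0 \<le> c" "d \<le> T" for c d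
    using set_integrable_subset[OF r(1), of "{c..d}"] that by (auto simp: set_integrable_def)
  have "(LBINT u:{0..t}. r u)
      \<le> (\<integral>u. indicator {0..min t h} u *\<^sub>R r u + indicator {h..h'} u *\<^sub>R r u \<partial>lborel)"
    unfolding set_lebesgue_integral_def
    by (intro integral_mono Bochner_Integration.integrable_add int)
      (use assms in \<open>auto split: split_indicator\<close>)
  also have "\<dots> = (LBINT u:{0..min t h}. r u) + (LBINT u:{h..h'}. r u)"
    unfolding set_lebesgue_integral_def
    by (intro Bochner_Integration.integral_add int) (use assms in auto)
  finally have "(LBINT u:{0..t}. r u) \<le> (LBINT u:{0..min t h}. r u) + (LBINT u:{h..h'}. r u)" .
  moreover have "b * exp (- m * t) \<le> b * exp (- m * min t h)"
    using assms by (intro mult_left_mono) (auto intro!: mult_left_mono)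
  moreover have "s = h" "min t h' = t" using False assms by auto
  ultimately show ?thesis
    by (simp add: payoff_def)
qed

text \<open>
  If the horizon shrinks, truncation favours the minimiser: a stop that falls at or after the new
  horizon leaves only the amount \<open>b\<close> to be paid, whereas in the long game a tie at that time costs
  \<open>a\<close>.
\<close>
lemma payoff_shorten:
  assumes "b \<le> a" "s \<le> h'" "t \<le> h" "h \<le> h'"
  shows "payoff a b m h r (min s h) t \<le> payoff a b m h' r s t"
proof -
  have "b * exp (- m * t) \<le> a * exp (- m * t)"
    using assms by (intro mult_right_mono) auto
  moreover have "s = t" if "h \<le> s" "s \<le> t" using that assms by simp
  ultimately show ?thesis
    using assms by (auto simp: payoff_def min_def)
qed

lemma payoff_change_reward:
  assumes "set_integrable lborel {0..T} r" "set_integrable lborel {0..T} r'"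
    and "s \<le> T"
  shows "payoff a b m h r s t \<le> payoff a b m h r' s t + (LBINT u:{0..T}. \<bar>r u - r' u\<bar>)"
proof -
  have int: "set_integrable lborel {0..min t s} r" "set_integrable lborel {0..min t s} r'"
    using assms by (auto intro: set_integrable_subset)
  have diff: "set_integrable lborel {0..T} (\<lambda>u. \<bar>r u - r' u\<bar>)"
    using assms by (intro set_integrable_abs set_integral_diff)
  have "(LBINT u:{0..min t s}. r u)
      \<le> (\<integral>u. indicator {0..min t s} u *\<^sub>R r' u + indicator {0..T} u *\<^sub>R \<bar>r u - r' u\<bar> \<partial>lborel)"
    using int diff unfolding set_lebesgue_integral_def set_integrable_def
    by (intro integral_mono Bochner_Integration.integrable_add)
      (use \<open>s \<le> T\<close> in \<open>auto split: split_indicator\<close>)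
  also have "\<dots> = (LBINT u:{0..min t s}. r' u) + (LBINT u:{0..T}. \<bar>r u - r' u\<bar>)"
    using int diff unfolding set_lebesgue_integral_def set_integrable_def
    by (intro Bochner_Integration.integral_add)
  finally show ?thesis by (simp add: payoff_def)
qed

lemma payoff_bounds:
  assumes "set_integrable lborel {0..T} r" "\<And>u. 0 \<le> r u"
    and "0 \<le> b" "b \<le> a" "0 \<le> m" "0 \<le> s" "s \<le> T" "0 \<le> t"
  shows "0 \<le> payoff a b m h r s t" "payoff a b m h r s t \<le> a + (LBINT u:{0..T}. r u)"
proof -
  have int: "set_integrable lborel {0..min t s} r"
    using assms by (auto intro: set_integrable_subset)
  have "0 \<le> (LBINT u:{0..min t s}. r u)"
    unfolding set_lebesgue_integral_def by (intro integral_nonneg_AE) (simp add: assms)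
  moreover have "(LBINT u:{0..min t s}. r u) \<le> (LBINT u:{0..T}. r u)"
    using assms(1,2,7) int unfolding set_lebesgue_integral_def set_integrable_def
    by (auto intro!: integral_mono split: split_indicator)
  moreover have "c * exp (- m * u) \<in> {0..a}" if "0 \<le> u" "0 \<le> c" "c \<le> a" for c u
    using mult_mono[of c a "exp (- m * u)" 1] that assms by auto
  ultimately show "0 \<le> payoff a b m h r s t" "payoff a b m h r s t \<le> a + (LBINT u:{0..T}. r u)"
    using assms by (auto simp: payoff_def intro!: add_nonneg_nonneg add_mono)
qed

section \<open>The derivative of a concave function\<close>

text \<open>
  Tangents at points of \<open>(0,\<infinity>)\<close> lie above the graph on all of \<open>[0,\<infinity>)\<close>, the end point \<open>0\<close>
  included; that case bounds the derivative near \<open>0\<close>.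
\<close>
lemma concave_tangent:
  fixes R :: "real \<Rightarrow> real"
  assumes "strictly_concave_on {0..} R" "R differentiable at x" "0 < x" "0 \<le> z"
  shows "R z \<le> R x + deriv R x * (z - x)"
proof -
  have "convex_on {0..} (\<lambda>x. - R x)"
  proof (rule convex_onI)
    fix u x y :: real assume u: "0 < u" "u < 1" and xy: "x \<in> {0..}" "y \<in> {0..}"
    show "- R ((1 - u) *\<^sub>R x + u *\<^sub>R y) \<le> (1 - u) * - R x + u * - R y"
    proof (cases "x = y")
      case True then show ?thesis by (simp add: algebra_simps)
    next
      case False
      then have "(1 - u) * R x + u * R y < R ((1 - u) * x + u * y)"
        using assms(1) u xy by (auto simp: strictly_concave_on_def)
      then show ?thesis by simp
    qed
  qed simp
  then have above: "(\<lambda>x. - R x) z - (\<lambda>x. - R x) x \<ge> c * (z - x)"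
    if "((\<lambda>x. - R x) has_real_derivative c) (at x within {0..})" for c
    using that assms by (intro convex_on_imp_above_tangent) (simp_all add: interior_real_atLeast)
  have "((\<lambda>x. - R x) has_real_derivative - deriv R x) (at x within {0..})"
    by (rule has_field_derivative_at_within[OF DERIV_minus])
      (use assms(2) in \<open>simp add: DERIV_deriv_iff_real_differentiable\<close>)
  from above[OF this] show ?thesis by simp
qed

lemma concave_deriv_antimono:
  fixes R :: "real \<Rightarrow> real"
  assumes "strictly_concave_on {0..} R" "\<And>x. 0 < x \<Longrightarrow> R differentiable at x" "0 < x" "x \<le> y"
  shows "deriv R y \<le> deriv R x"
proof (cases "x = y")
  case False
  have "R y \<le> R x + deriv R x * (y - x)" "R x \<le> R y + deriv R y * (x - y)"
    using assms by (auto intro!: concave_tangent)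
  then have "0 \<le> (deriv R x - deriv R y) * (y - x)"
    by (simp add: algebra_simps)
  with False \<open>x \<le> y\<close> show ?thesis by (simp add: zero_le_mult_iff)
qed simp

text \<open>
  The marginal reward may blow up at \<open>0\<close>, but no faster than \<open>1 / x\<close>: for \<open>x \<le> 1\<close> the tangent at
  \<open>x\<close> evaluated at \<open>0\<close> gives \<open>x R'(x) \<le> R x \<le> R 1\<close>, and for \<open>x \<ge> 1\<close> the derivative is at most
  \<open>R'(1)\<close>. Means of the marginal reward are thereby controlled by the mean of
  \<open>1 / x\<close> along the price process.
\<close>
lemma concave_deriv_bounds:
  fixes R :: "real \<Rightarrow> real"
  assumes R: "strictly_concave_on {0..} R" "\<And>x. 0 < x \<Longrightarrow> R differentiable at x"
    and mono: "mono_on {0..} R" and "R 0 = 0" and "0 < x"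
  shows "0 \<le> deriv R x" "deriv R x \<le> deriv R 1 + R 1 / x"
proof -
  have nonneg: "0 \<le> deriv R x" if "0 < x" for x
    using concave_tangent[OF R(1) R(2)[OF that] that, of "x + 1"]
      mono_onD[OF mono, of x "x + 1"] that by simp
  then show "0 \<le> deriv R x" using \<open>0 < x\<close> .
  show "deriv R x \<le> deriv R 1 + R 1 / x"
  proof (cases "x \<le> 1")
    case True
    have "0 \<le> R x + deriv R x * (0 - x)"
      using concave_tangent[OF R(1) R(2)[OF \<open>0 < x\<close>] \<open>0 < x\<close>, of 0] \<open>R 0 = 0\<close> by simp
    also have "R x \<le> R 1" using mono_onD[OF mono, of x 1] True \<open>0 < x\<close> by simp
    finally have "deriv R x \<le> R 1 / x" using \<open>0 < x\<close> by (simp add: field_simps)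
    with nonneg[of 1] show ?thesis by simp
  next
    case False
    moreover have "0 \<le> R 1" using mono_onD[OF mono, of 0 1] \<open>R 0 = 0\<close> by simp
    ultimately show ?thesis
      using concave_deriv_antimono[OF R, of 1 x] by (simp add: add_increasing2)
  qed
qed

section \<open>The augmented filtration and its stopping times\<close>

lemma space_augmented_filtration [simp]: "space (augmented_filtration M W t) = space M"
  by (simp add: augmented_filtration_def space_measure_of_conv)

lemma space_natural_filtration [simp]: "space (natural_filtration M W t) = space M"
  by (simp add: natural_filtration_def space_measure_of_conv)

lemma sets_natural_filtration:
  "sets (natural_filtration M W t) =
     sigma_sets (space M) {W s -` B \<inter> space M | s B. s \<in> {0..t} \<and> B \<in> sets borel}"
  unfolding natural_filtration_def by (rule sets_measure_of) auto

lemma sets_augmented_filtration: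
  "sets (augmented_filtration M W t) =
     sigma_sets (space M) (sets (natural_filtration M W t) \<union> null_sets M)"
proof -
  have "sets (natural_filtration M W t) \<subseteq> Pow (space M)"
    using sets.space_closed[of "natural_filtration M W t"] by simp
  moreover have "null_sets M \<subseteq> Pow (space M)"
    using sets.space_closed[of M] by auto
  ultimately show ?thesis
    unfolding augmented_filtration_def by (intro sets_measure_of) simp
qed

lemma null_sets_subset_augmented_filtration:
  "N \<in> null_sets M \<Longrightarrow> N \<in> sets (augmented_filtration M W t)"
  by (simp add: sets_augmented_filtration sigma_sets.Basic)

lemma filtration_augmented: "filtration (space M) (augmented_filtration M W)"
proof
  fix s t :: real assume "s \<le> t"
  then have "sets (natural_filtration M W s) \<subseteq> sets (natural_filtration M W t)"
    unfolding sets_natural_filtration by (intro sigma_sets_mono') fastforce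
  then show "sets (augmented_filtration M W s) \<subseteq> sets (augmented_filtration M W t)"
    unfolding sets_augmented_filtration by (intro sigma_sets_mono') auto
qed simp

lemma measurable_augmented_filtration:
  assumes "0 \<le> t"
  shows "W t \<in> borel_measurable (augmented_filtration M W t)"
proof (rule measurableI)
  fix B :: "real set" assume "B \<in> sets borel"
  then have "W t -` B \<inter> space M \<in> sets (natural_filtration M W t)"
    unfolding sets_natural_filtration using assms by (intro sigma_sets.Basic) auto
  then show "W t -` B \<inter> space (augmented_filtration M W t) \<in> sets (augmented_filtration M W t)"
    by (simp add: sets_augmented_filtration sigma_sets.Basic)
qed simp

lemma subalgebra_augmented_filtration:
  assumes "\<And>t. 0 \<le> t \<Longrightarrow> W t \<in> borel_measurable M"
  shows "subalgebra M (augmented_filtration M W t)"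
proof -
  have "sets (natural_filtration M W t) \<subseteq> sets M"
    unfolding sets_natural_filtration
    using assms by (intro sets.sigma_sets_subset) (auto simp: measurable_sets)
  then have "sets (augmented_filtration M W t) \<subseteq> sets M"
    unfolding sets_augmented_filtration by (intro sets.sigma_sets_subset) auto
  then show ?thesis by (simp add: subalgebra_def)
qed

lemma stopping_times_measurable:
  assumes "\<And>t. 0 \<le> t \<Longrightarrow> W t \<in> borel_measurable M" and "\<tau> \<in> stopping_times M W h"
  shows "\<tau> \<in> borel_measurable M"
proof (rule measurable_stopping_time)
  show "stopping_time (augmented_filtration M W) \<tau>"
    using assms(2) by (simp add: stopping_times_def)
qed (use subalgebra_augmented_filtration[OF assms(1)] in \<open>auto simp: subalgebra_def\<close>)

lemma stopping_times_zero: "0 \<le> h \<Longrightarrow> (\<lambda>_. 0) \<in> stopping_times M W h"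
  by (simp add: stopping_times_def stopping_time_const)

lemma stopping_times_mono: "h \<le> h' \<Longrightarrow> stopping_times M W h \<subseteq> stopping_times M W h'"
  by (force simp: stopping_times_def)

lemma stopping_times_truncate:
  "0 \<le> h \<Longrightarrow> \<tau> \<in> stopping_times M W h' \<Longrightarrow> (\<lambda>\<omega>. min (\<tau> \<omega>) h) \<in> stopping_times M W h"
  by (auto simp: stopping_times_def intro!: stopping_time_min stopping_time_const)

text \<open>
  Between \<open>h\<close> and \<open>h'\<close> the postponed time has passed exactly when \<open>\<sigma> < h\<close>, an event already known at
  time \<open>h\<close>; so postponing does not anticipate.
\<close>
lemma stopping_times_extend:
  assumes "h \<le> h'" and \<sigma>: "\<sigma> \<in> stopping_times M W h"
  shows "(\<lambda>\<omega>. if \<sigma> \<omega> < h then \<sigma> \<omega> else h') \<in> stopping_times M W h'"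
proof -
  interpret filtration "space M" "augmented_filtration M W" by (rule filtration_augmented)
  let ?F = "augmented_filtration M W"
  have st: "stopping_time ?F \<sigma>" and range: "\<And>\<omega>. \<omega> \<in> space M \<Longrightarrow> 0 \<le> \<sigma> \<omega> \<and> \<sigma> \<omega> \<le> h"
    using \<sigma> by (auto simp: stopping_times_def)
  have "Measurable.pred (?F t) (\<lambda>\<omega>. (if \<sigma> \<omega> < h then \<sigma> \<omega> else h') \<le> t)" for t
  proof -
    consider "t < h" | "h \<le> t" "t < h'" | "h' \<le> t" by linarith
    then show ?thesis
    proof cases
      case 1
      then have eq: "(if \<sigma> \<omega> < h then \<sigma> \<omega> else h') \<le> t \<longleftrightarrow> \<sigma> \<omega> \<le> t" if "\<omega> \<in> space (?F t)" for \<omega>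
        using \<open>h \<le> h'\<close> by auto
      show ?thesis
        by (rule measurable_cong[THEN iffD2, OF eq stopping_timeD[OF st]])
    next
      case 2
      then have eq: "(if \<sigma> \<omega> < h then \<sigma> \<omega> else h') \<le> t \<longleftrightarrow> \<sigma> \<omega> < h" if "\<omega> \<in> space (?F t)" for \<omega>
        by auto
      have lt: "Measurable.pred (?F t) (\<lambda>\<omega>. \<sigma> \<omega> < h)"
        using stopping_time_less_const[OF st, of h] sets_F_mono[OF \<open>h \<le> t\<close>]
        by (auto simp: pred_def)
      show ?thesis
        by (rule measurable_cong[THEN iffD2, OF eq lt])
    next
      case 3
      then have "(if \<sigma> \<omega> < h then \<sigma> \<omega> else h') \<le> t" for \<omega>
        using \<open>h \<le> h'\<close> by auto
      then show ?thesis by simp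
    qed
  qed
  then have "stopping_time ?F (\<lambda>\<omega>. if \<sigma> \<omega> < h then \<sigma> \<omega> else h')"
    by (rule stopping_timeI)
  moreover have "(if \<sigma> \<omega> < h then \<sigma> \<omega> else h') \<in> {0..h'}" if "\<omega> \<in> space M" for \<omega>
    using range[OF that] assms(1) by auto
  ultimately show ?thesis by (simp add: stopping_times_def)
qed

section \<open>Integration under the changed measure\<close>

text \<open>
  The density is given on the \<open>\<sigma>\<close>-algebra at time \<open>t\<close> only, so the integrand must be measurable with
  respect to it.
\<close>
lemma nn_integral_tilde_measure:
  assumes tilde: "tilde_measure M W T \<sigma> Q"
    and W: "\<And>t. 0 \<le> t \<Longrightarrow> W t \<in> borel_measurable M"
    and t: "0 \<le> t" "t \<le> T"
    and f: "f \<in> borel_measurable (augmented_filtration M W t)"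
  shows "(\<integral>\<^sup>+\<omega>. f \<omega> \<partial>Q) = (\<integral>\<^sup>+\<omega>. ennreal (exp (- (1/2) * \<sigma>\<^sup>2 * t + \<sigma> * W t \<omega>)) * f \<omega> \<partial>M)"
proof -
  let ?F = "augmented_filtration M W t"
  have subM: "subalgebra M ?F" by (rule subalgebra_augmented_filtration[OF W])
  then have subQ: "subalgebra Q ?F"
    using tilde by (simp add: tilde_measure_def subalgebra_def)
  note [measurable] = measurable_augmented_filtration[OF t(1), of W M] f
  have [measurable]: "W t \<in> borel_measurable (restr_to_subalg M ?F)"
    "f \<in> borel_measurable (restr_to_subalg M ?F)"
    using measurable_augmented_filtration[OF t(1)] f subM by (auto intro: measurable_in_subalg)
  have "(\<integral>\<^sup>+\<omega>. f \<omega> \<partial>Q) = (\<integral>\<^sup>+\<omega>. f \<omega> \<partial>restr_to_subalg Q ?F)"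
    by (rule nn_integral_subalgebra2[OF subQ f, symmetric])
  also have "restr_to_subalg Q ?F = density (restr_to_subalg M ?F)
      (\<lambda>\<omega>. ennreal (exp (- (1/2) * \<sigma>\<^sup>2 * t + \<sigma> * W t \<omega>)))"
    using tilde t by (simp add: tilde_measure_def)
  also have "(\<integral>\<^sup>+\<omega>. f \<omega> \<partial>\<dots>) =
      (\<integral>\<^sup>+\<omega>. ennreal (exp (- (1/2) * \<sigma>\<^sup>2 * t + \<sigma> * W t \<omega>)) * f \<omega> \<partial>restr_to_subalg M ?F)"
    by (rule nn_integral_density) measurable
  also have "\<dots> = (\<integral>\<^sup>+\<omega>. ennreal (exp (- (1/2) * \<sigma>\<^sup>2 * t + \<sigma> * W t \<omega>)) * f \<omega> \<partial>M)"
    by (rule nn_integral_subalgebra2[OF subM]) measurable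
  finally show ?thesis .
qed

text \<open>
  A null set belongs to the augmented filtration already at time \<open>0\<close>, where \<open>Q\<close> has a density.
\<close>
lemma null_sets_tilde_measure:
  assumes tilde: "tilde_measure M W T \<sigma> Q" and "0 \<le> T"
    and W: "\<And>t. 0 \<le> t \<Longrightarrow> W t \<in> borel_measurable M"
    and N: "N \<in> null_sets M"
  shows "N \<in> null_sets Q"
proof
  have sets: "N \<in> sets (augmented_filtration M W 0)" "N \<in> sets Q"
    using N tilde by (auto intro: null_sets_subset_augmented_filtration simp: tilde_measure_def)
  have "emeasure Q N = (\<integral>\<^sup>+\<omega>. ennreal (exp (- (1/2) * \<sigma>\<^sup>2 * 0 + \<sigma> * W 0 \<omega>)) * indicator N \<omega> \<partial>M)"
    using sets nn_integral_tilde_measure[OF tilde W order.refl \<open>0 \<le> T\<close>, of "indicator N"]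
    by (simp add: nn_integral_indicator)
  also have "\<dots> = (\<integral>\<^sup>+\<omega>. 0 \<partial>M)"
    using AE_not_in[OF N] by (intro nn_integral_cong_AE) (auto elim!: eventually_mono)
  finally show "emeasure Q N = 0" by simp
  show "N \<in> sets Q" by fact
qed

text \<open>
  The price process is a discount factor times the density of \<open>Q\<close>. Hence the \<open>Q\<close>-mean of its
  reciprocal is computed by cancellation.
\<close>
lemma C0_alt: "C0 W \<mu> \<sigma> t \<omega> = exp (- \<mu> * t) * exp (- (1/2) * \<sigma>\<^sup>2 * t + \<sigma> * W t \<omega>)"
  by (simp add: C0_def exp_add[symmetric] power2_eq_square algebra_simps)

lemma C0_pos: "0 < C0 W \<mu> \<sigma> t \<omega>"
  by (simp add: C0_def)

lemma nn_integral_inverse_C0: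
  assumes tilde: "tilde_measure M W T \<sigma> Q" and "prob_space M"
    and W: "\<And>t. 0 \<le> t \<Longrightarrow> W t \<in> borel_measurable M" and t: "0 \<le> t" "t \<le> T"
  shows "(\<integral>\<^sup>+\<omega>. ennreal (1 / C0 W \<mu> \<sigma> t \<omega>) \<partial>Q) = ennreal (exp (\<mu> * t))"
proof -
  interpret prob_space M by fact
  note [measurable] = measurable_augmented_filtration[OF t(1), of W M]
  have "(\<integral>\<^sup>+\<omega>. ennreal (1 / C0 W \<mu> \<sigma> t \<omega>) \<partial>Q) =
      (\<integral>\<^sup>+\<omega>. ennreal (exp (- (1/2) * \<sigma>\<^sup>2 * t + \<sigma> * W t \<omega>)) * ennreal (1 / C0 W \<mu> \<sigma> t \<omega>) \<partial>M)"
    by (rule nn_integral_tilde_measure[OF tilde W t]) (auto simp: C0_alt)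
  also have "\<dots> = (\<integral>\<^sup>+\<omega>. ennreal (exp (\<mu> * t)) \<partial>M)"
    by (intro nn_integral_cong) (simp add: C0_alt ennreal_mult[symmetric] exp_minus field_simps)
  finally show ?thesis by (simp add: emeasure_space_1)
qed

section \<open>Regularisation of paths and joint measurability\<close>

text \<open>
  Rounding the time argument to a grid gives a jointly measurable process, since only countably many
  times occur; by continuity these approximations converge as the grid is refined.
\<close>
lemma measurable_continuous_process:
  fixes X :: "real \<Rightarrow> 'a \<Rightarrow> real"
  assumes X: "\<And>t. X t \<in> borel_measurable M"
    and cont: "\<And>\<omega>. \<omega> \<in> space M \<Longrightarrow> continuous_on UNIV (\<lambda>t. X t \<omega>)"
  shows "(\<lambda>(\<omega>, t). X t \<omega>) \<in> borel_measurable (M \<Otimes>\<^sub>M lborel)"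
proof -
  define q :: "nat \<Rightarrow> real \<Rightarrow> real" where "q n t = of_int \<lfloor>of_nat (Suc n) * t\<rfloor> / of_nat (Suc n)" for n t
  have q: "(\<lambda>n. q n t) \<longlonglongrightarrow> t" for t
  proof (rule LIM_zero_cancel, rule LIMSEQ_norm_0)
    show "norm (q n t - t) < 1 / real (Suc n)" for n
    proof -
      have "\<bar>of_int \<lfloor>real (Suc n) * t\<rfloor> - real (Suc n) * t\<bar> < 1" by linarith
      moreover have "q n t - t = (of_int \<lfloor>real (Suc n) * t\<rfloor> - real (Suc n) * t) / real (Suc n)"
        by (simp add: q_def field_simps)
      ultimately show ?thesis by (simp add: divide_strict_right_mono)
    qed
  qed
  show ?thesis
  proof (rule borel_measurable_LIMSEQ_real)
    fix p :: "'a \<times> real" assume "p \<in> space (M \<Otimes>\<^sub>M lborel)"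
    then have "continuous_on UNIV (\<lambda>t. X t (fst p))" by (auto simp: space_pair_measure cont)
    then have "isCont (\<lambda>t. X t (fst p)) (snd p)" by (simp add: continuous_on_eq_continuous_at)
    from isCont_tendsto_compose[OF this q]
    show "(\<lambda>n. X (q n (snd p)) (fst p)) \<longlonglongrightarrow> (case p of (\<omega>, t) \<Rightarrow> X t \<omega>)"
      by (simp add: case_prod_beta)
  next
    fix n
    note [measurable] = X
    have "(\<lambda>p. (\<lambda>k p. X (of_int k / real (Suc n)) (fst p)) \<lfloor>real (Suc n) * snd p\<rfloor> p)
        \<in> borel_measurable (M \<Otimes>\<^sub>M lborel)"
      by (rule measurable_compose_countable) measurable
    then show "(\<lambda>p. X (q n (snd p)) (fst p)) \<in> borel_measurable (M \<Otimes>\<^sub>M lborel)"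
      by (simp add: q_def)
  qed
qed

lemma (in complete_measure) borel_measurable_modification:
  fixes f g :: "'a \<Rightarrow> real"
  assumes f: "f \<in> borel_measurable M" and N: "N \<in> null_sets M"
    and eq: "\<And>\<omega>. \<omega> \<in> space M - N \<Longrightarrow> g \<omega> = f \<omega>"
  shows "g \<in> borel_measurable M"
proof (rule measurableI)
  fix B :: "real set" assume "B \<in> sets borel"
  then have "f -` B \<inter> space M \<in> sets M" by (rule measurable_sets[OF f])
  moreover have "AE \<omega> in M. \<omega> \<in> f -` B \<inter> space M \<longleftrightarrow> \<omega> \<in> g -` B \<inter> space M"
    using AE_not_in[OF N] AE_space by eventually_elim (simp add: eq)
  ultimately show "g -` B \<inter> space M \<in> sets M"
    using in_sets_AE[of "f -` B \<inter> space M" "g -` B \<inter> space M"] by simp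
qed simp

text \<open>
  Almost all paths are continuous on \<open>[0,\<infinity>)\<close>; the exceptional ones are replaced by \<open>0\<close>, and every path
  is extended to negative times by its value at \<open>0\<close>, which makes it continuous on the whole line.
\<close>
lemma ex_continuous_modification:
  assumes "brownian_motion M W"
  obtains X :: "real \<Rightarrow> 'a \<Rightarrow> real" and N where "N \<in> null_sets M"
    "\<And>t. X t \<in> borel_measurable M"
    "\<And>\<omega>. continuous_on UNIV (\<lambda>t. X t \<omega>)"
    "\<And>\<omega> t. \<omega> \<in> space M - N \<Longrightarrow> 0 \<le> t \<Longrightarrow> X t \<omega> = W t \<omega>"
proof -
  have W: "\<And>t. 0 \<le> t \<Longrightarrow> W t \<in> borel_measurable M"
    and "AE \<omega> in M. continuous_on {0..} (\<lambda>t. W t \<omega>)"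
    using assms by (auto simp: brownian_motion_def)
  then obtain N where N: "N \<in> null_sets M"
    and cont: "{\<omega> \<in> space M. \<not> continuous_on {0..} (\<lambda>t. W t \<omega>)} \<subseteq> N"
    by (auto simp: eventually_ae_filter)
  define X where "X t \<omega> = (if \<omega> \<in> space M - N then W (max 0 t) \<omega> else 0)" for t \<omega>
  show thesis
  proof (rule that[OF N])
    have [measurable]: "N \<in> sets M" using N by auto
    have [measurable]: "W (max 0 t) \<in> borel_measurable M" for t by (intro W) simp
    show "X t \<in> borel_measurable M" for t
      unfolding X_def[abs_def] by measurable
    show "continuous_on UNIV (\<lambda>t. X t \<omega>)" for \<omega>
    proof (cases "\<omega> \<in> space M - N")
      case True
      then have "continuous_on {0..} (\<lambda>t. W t \<omega>)" using cont by auto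
      then have "continuous_on UNIV (\<lambda>t. W (max 0 t) \<omega>)"
        by (rule continuous_on_compose2) (auto intro!: continuous_intros)
      with True show ?thesis by (simp add: X_def)
    next
      case False
      then have "X t \<omega> = 0" for t by (simp only: X_def if_False)
      then show ?thesis by simp
    qed
    show "X t \<omega> = W t \<omega>" if "\<omega> \<in> space M - N" "0 \<le> t" for \<omega> t
      using that by (simp add: X_def)
  qed
qed

section \<open>The game in expectation\<close>

text \<open>
  The stochastic game, reduced to what the comparison of values uses. The process \<open>r y\<close> is the
  running reward rate for the initial state \<open>y\<close>, with mean at most \<open>L y\<close> at all times up to \<open>T\<close>, and
  \<open>S h\<close> is the set of strategies for the horizon \<open>h\<close>. Its closure properties are those under which
  strategies can be translated between horizons.
\<close>
locale stopping_game = prob_space Q for Q :: "'a measure" +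
  fixes T a b m :: real and r :: "real \<Rightarrow> real \<Rightarrow> 'a \<Rightarrow> real" and L :: "real \<Rightarrow> real"
    and S :: "real \<Rightarrow> ('a \<Rightarrow> real) set"
  assumes b_nonneg: "0 \<le> b" and b_le_a: "b \<le> a" and m_nonneg: "0 \<le> m" and T_nonneg: "0 \<le> T"
    and r_measurable: "0 < y \<Longrightarrow> (\<lambda>(\<omega>, u). r y u \<omega>) \<in> borel_measurable (Q \<Otimes>\<^sub>M lborel)"
    and r_nonneg: "0 < y \<Longrightarrow> 0 \<le> r y u \<omega>"
    and r_antimono: "0 < y \<Longrightarrow> y \<le> y' \<Longrightarrow> r y' u \<omega> \<le> r y u \<omega>"
    and r_continuous: "0 < y \<Longrightarrow> isCont (\<lambda>y. r y u \<omega>) y"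
    and L_nonneg: "0 < y \<Longrightarrow> 0 \<le> L y"
    and r_mean: "0 < y \<Longrightarrow> 0 \<le> u \<Longrightarrow> u \<le> T \<Longrightarrow> (\<integral>\<^sup>+\<omega>. ennreal (r y u \<omega>) \<partial>Q) \<le> ennreal (L y)"
    and S_measurable: "\<tau> \<in> S h \<Longrightarrow> \<tau> \<in> borel_measurable Q"
    and S_range: "\<tau> \<in> S h \<Longrightarrow> \<omega> \<in> space Q \<Longrightarrow> 0 \<le> \<tau> \<omega> \<and> \<tau> \<omega> \<le> h"
    and S_nonempty: "0 \<le> h \<Longrightarrow> S h \<noteq> {}"
    and S_mono: "h \<le> h' \<Longrightarrow> S h \<subseteq> S h'"
    and S_truncate: "0 \<le> h \<Longrightarrow> \<tau> \<in> S h' \<Longrightarrow> (\<lambda>\<omega>. min (\<tau> \<omega>) h) \<in> S h"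
    and S_extend: "h \<le> h' \<Longrightarrow> \<sigma> \<in> S h \<Longrightarrow> (\<lambda>\<omega>. if \<sigma> \<omega> < h then \<sigma> \<omega> else h') \<in> S h'"
begin

sublocale pair_sigma_finite Q lborel ..

definition reward :: "real \<Rightarrow> real \<Rightarrow> real \<Rightarrow> 'a \<Rightarrow> real" where
  "reward y c d \<omega> = (LBINT u:{c..d}. r y u \<omega>)"

definition mean_payoff :: "real \<Rightarrow> real \<Rightarrow> ('a \<Rightarrow> real) \<Rightarrow> ('a \<Rightarrow> real) \<Rightarrow> real" where
  "mean_payoff h y \<sigma> \<tau> = (\<integral>\<omega>. payoff a b m h (\<lambda>u. r y u \<omega>) (\<sigma> \<omega>) (\<tau> \<omega>) \<partial>Q)"

abbreviation window :: "real \<Rightarrow> real \<Rightarrow> real \<Rightarrow> 'a \<times> real \<Rightarrow> real" where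
  "window y c d \<equiv> \<lambda>p. indicator {c..d} (snd p) *\<^sub>R r y (snd p) (fst p)"

lemma window_measurable: "0 < y \<Longrightarrow> window y c d \<in> borel_measurable (Q \<Otimes>\<^sub>M lborel)"
  using r_measurable[of y] by (simp add: case_prod_beta)

lemma nn_integral_window:
  assumes "0 < y" "0 \<le> c" "c \<le> d" "d \<le> T"
  shows "(\<integral>\<^sup>+p. ennreal (window y c d p) \<partial>(Q \<Otimes>\<^sub>M lborel)) \<le> ennreal (L y * (d - c))"
proof -
  have "(\<integral>\<^sup>+p. ennreal (window y c d p) \<partial>(Q \<Otimes>\<^sub>M lborel)) =
      (\<integral>\<^sup>+u. \<integral>\<^sup>+\<omega>. ennreal (window y c d (\<omega>, u)) \<partial>Q \<partial>lborel)"
    using window_measurable[OF \<open>0 < y\<close>, of c d] by (subst nn_integral_snd[symmetric]) simp_all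
  also have "\<dots> \<le> (\<integral>\<^sup>+u. ennreal (L y) * indicator {c..d} u \<partial>lborel)"
    using assms r_mean by (intro nn_integral_mono) (auto split: split_indicator)
  also have "\<dots> = ennreal (L y * (d - c))"
    using assms L_nonneg by (simp add: nn_integral_cmult_indicator ennreal_mult)
  finally show ?thesis .
qed

lemma integrable_window:
  assumes "0 < y" "0 \<le> c" "c \<le> d" "d \<le> T"
  shows "integrable (Q \<Otimes>\<^sub>M lborel) (window y c d)"
proof (rule integrableI_nonneg)
  show "AE p in Q \<Otimes>\<^sub>M lborel. 0 \<le> window y c d p"
    using r_nonneg[OF assms(1)] by simp
  show "(\<integral>\<^sup>+p. ennreal (window y c d p) \<partial>(Q \<Otimes>\<^sub>M lborel)) < \<infinity>"
    using nn_integral_window[OF assms] by (rule le_less_trans) simp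
qed (rule window_measurable[OF assms(1)])

lemma integrable_reward: "0 < y \<Longrightarrow> 0 \<le> c \<Longrightarrow> c \<le> d \<Longrightarrow> d \<le> T \<Longrightarrow> integrable Q (reward y c d)"
  using integrable_fst'[OF integrable_window] by (simp add: reward_def[abs_def] set_lebesgue_integral_def)

lemma mean_reward:
  "0 < y \<Longrightarrow> 0 \<le> c \<Longrightarrow> c \<le> d \<Longrightarrow> d \<le> T \<Longrightarrow>
     expectation (reward y c d) = (\<integral>p. window y c d p \<partial>(Q \<Otimes>\<^sub>M lborel))"
  using integral_fst'[OF integrable_window] by (simp add: reward_def[abs_def] set_lebesgue_integral_def)

lemma mean_reward_le:
  assumes "0 < y" "0 \<le> c" "c \<le> d" "d \<le> T"
  shows "expectation (reward y c d) \<le> L y * (d - c)"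
proof -
  have "expectation (reward y c d) = enn2real (\<integral>\<^sup>+p. ennreal (window y c d p) \<partial>(Q \<Otimes>\<^sub>M lborel))"
    unfolding mean_reward[OF assms]
    using window_measurable[OF assms(1), of c d] r_nonneg[OF assms(1)]
    by (intro integral_eq_nn_integral) auto
  also have "\<dots> \<le> L y * (d - c)"
    using nn_integral_window[OF assms] assms L_nonneg by (intro enn2real_leI) auto
  finally show ?thesis .
qed

lemma AE_integrable_reward:
  assumes "0 < y"
  shows "AE \<omega> in Q. set_integrable lborel {0..T} (\<lambda>u. r y u \<omega>)"
  using AE_integrable_fst'[OF integrable_window[OF assms order.refl T_nonneg order.refl]]
  by (simp add: set_integrable_def)

text \<open>
  Rewards decrease in the state, so near \<open>y\<close> all of them are dominated by the integrable reward for
  \<open>y / 2\<close>.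
\<close>
lemma continuous_mean_reward:
  "continuous_on {0<..} (\<lambda>y. expectation (reward y 0 T))"
proof (rule continuous_on_sequentiallyI)
  fix ys :: "nat \<Rightarrow> real" and y assume ys: "\<forall>n. ys n \<in> {0<..}" "y \<in> {0<..}" "ys \<longlonglongrightarrow> y"
  then have y: "0 < y" and ys_pos: "\<And>n. 0 < ys n" by auto
  \<comment> \<open>Eventually the states exceed \<open>y / 2\<close>, whose reward dominates all later ones.\<close>
  obtain n0 where n0: "\<And>n. n0 \<le> n \<Longrightarrow> y / 2 < ys n"
    using order_tendstoD(1)[OF ys(3), of "y / 2"] y by (auto simp: eventually_sequentially)
  let ?g = "\<lambda>y. window y 0 T"
  have "(\<lambda>n. \<integral>p. ?g (ys (n + n0)) p \<partial>(Q \<Otimes>\<^sub>M lborel)) \<longlonglongrightarrow> (\<integral>p. ?g y p \<partial>(Q \<Otimes>\<^sub>M lborel))"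
  proof (rule integral_dominated_convergence)
    show "integrable (Q \<Otimes>\<^sub>M lborel) (?g (y / 2))"
      using y T_nonneg by (intro integrable_window) auto
    show "?g y \<in> borel_measurable (Q \<Otimes>\<^sub>M lborel)"
      by (rule window_measurable[OF y])
    show "?g (ys (n + n0)) \<in> borel_measurable (Q \<Otimes>\<^sub>M lborel)" for n
      by (rule window_measurable[OF ys_pos])
    have "(\<lambda>n. r (ys (n + n0)) u \<omega>) \<longlonglongrightarrow> r y u \<omega>" for u \<omega>
      by (rule isCont_tendsto_compose[OF r_continuous[OF y] LIMSEQ_ignore_initial_segment[OF ys(3)]])
    then show "AE p in Q \<Otimes>\<^sub>M lborel. (\<lambda>n. ?g (ys (n + n0)) p) \<longlonglongrightarrow> ?g y p"
      by (intro AE_I2 tendsto_intros)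
    show "AE p in Q \<Otimes>\<^sub>M lborel. norm (?g (ys (n + n0)) p) \<le> ?g (y / 2) p" for n
      using r_nonneg[OF ys_pos] r_antimono[of "y / 2" "ys (n + n0)"] n0[of "n + n0"] y
      by (intro AE_I2) (auto split: split_indicator)
  qed
  then have "(\<lambda>n. expectation (reward (ys (n + n0)) 0 T)) \<longlonglongrightarrow> expectation (reward y 0 T)"
    using y ys_pos T_nonneg by (simp add: mean_reward)
  then show "(\<lambda>n. expectation (reward (ys n) 0 T)) \<longlonglongrightarrow> expectation (reward y 0 T)"
    by (rule LIMSEQ_offset)
qed

text \<open>
  Monotonicity in the state fixes the sign of the difference along every path at once, so the
  mean of the accumulated absolute difference of two reward rates is just the absolute difference of the
  means of the total rewards.
\<close>
lemma mean_reward_diff: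
  assumes "0 < y" "0 < y'"
  shows "integrable Q (\<lambda>\<omega>. LBINT u:{0..T}. \<bar>r y u \<omega> - r y' u \<omega>\<bar>)" (is "integrable Q ?D")
    and "expectation (\<lambda>\<omega>. LBINT u:{0..T}. \<bar>r y u \<omega> - r y' u \<omega>\<bar>) =
      \<bar>expectation (reward y 0 T) - expectation (reward y' 0 T)\<bar>"
proof -
  define s :: real where "s = (if y \<le> y' then 1 else -1)"
  have s: "\<bar>r y u \<omega> - r y' u \<omega>\<bar> = s * (r y u \<omega> - r y' u \<omega>)" for u \<omega>
    using r_antimono[OF assms(1), of y' u \<omega>] r_antimono[OF assms(2), of y u \<omega>] by (simp add: s_def)
  have int: "integrable Q (reward y 0 T)" "integrable Q (reward y' 0 T)"
    using assms T_nonneg by (auto intro: integrable_reward)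
  note [measurable] = r_measurable[OF assms(1)] r_measurable[OF assms(2)]
  have [measurable]: "?D \<in> borel_measurable Q"
    unfolding set_lebesgue_integral_def by measurable
  have AE: "AE \<omega> in Q. ?D \<omega> = s * (reward y 0 T \<omega> - reward y' 0 T \<omega>)"
    using AE_integrable_reward[OF assms(1)] AE_integrable_reward[OF assms(2)]
    by eventually_elim (simp add: s reward_def set_integral_diff)
  have [measurable]: "reward y 0 T \<in> borel_measurable Q" "reward y' 0 T \<in> borel_measurable Q"
    using int by auto
  have "integrable Q (\<lambda>\<omega>. s * (reward y 0 T \<omega> - reward y' 0 T \<omega>))"
    using int by simp
  then show "integrable Q ?D"
    by (subst integrable_cong_AE[OF _ _ AE]) auto
  have eq: "expectation ?D = s * (expectation (reward y 0 T) - expectation (reward y' 0 T))"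
    using int by (subst integral_cong_AE[OF _ _ AE]) auto
  moreover have "0 \<le> expectation ?D"
    unfolding set_lebesgue_integral_def by (intro integral_nonneg_AE AE_I2) auto
  moreover have "\<bar>s\<bar> = 1" by (simp add: s_def)
  ultimately have "expectation ?D = \<bar>s * (expectation (reward y 0 T) - expectation (reward y' 0 T))\<bar>"
    by simp
  with \<open>\<bar>s\<bar> = 1\<close> show "expectation ?D = \<bar>expectation (reward y 0 T) - expectation (reward y' 0 T)\<bar>"
    by (simp add: abs_mult)
qed

lemma payoff_measurable:
  assumes "0 < y" "\<sigma> \<in> S h" "\<tau> \<in> S h"
  shows "(\<lambda>\<omega>. payoff a b m h (\<lambda>u. r y u \<omega>) (\<sigma> \<omega>) (\<tau> \<omega>)) \<in> borel_measurable Q"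
proof -
  note [measurable] = r_measurable[OF assms(1)] S_measurable[OF assms(2)] S_measurable[OF assms(3)]
  have "(\<lambda>(\<omega>, u). indicator {0..min (\<tau> \<omega>) (\<sigma> \<omega>)} u *\<^sub>R r y u \<omega>) =
      (\<lambda>(\<omega>, u). if 0 \<le> u \<and> u \<le> \<tau> \<omega> \<and> u \<le> \<sigma> \<omega> then r y u \<omega> else 0)"
    by (auto simp: fun_eq_iff)
  also have "\<dots> \<in> borel_measurable (Q \<Otimes>\<^sub>M lborel)"
    by measurable
  finally have [measurable]:
    "(\<lambda>(\<omega>, u). indicator {0..min (\<tau> \<omega>) (\<sigma> \<omega>)} u *\<^sub>R r y u \<omega>) \<in> borel_measurable (Q \<Otimes>\<^sub>M lborel)" .
  have "(\<lambda>\<omega>. LBINT u:{0..min (\<tau> \<omega>) (\<sigma> \<omega>)}. r y u \<omega>) \<in> borel_measurable Q"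
    unfolding set_lebesgue_integral_def by measurable
  then show ?thesis unfolding payoff_def by measurable
qed

lemma AE_payoff_bounds:
  assumes "0 < y" "0 \<le> h" "h \<le> T" "\<sigma> \<in> S h" "\<tau> \<in> S h"
  shows "AE \<omega> in Q. 0 \<le> payoff a b m h (\<lambda>u. r y u \<omega>) (\<sigma> \<omega>) (\<tau> \<omega>) \<and>
           payoff a b m h (\<lambda>u. r y u \<omega>) (\<sigma> \<omega>) (\<tau> \<omega>) \<le> a + reward y 0 T \<omega>"
  using AE_integrable_reward[OF assms(1)] AE_space
proof eventually_elim
  case (elim \<omega>)
  with S_range[OF assms(4)] S_range[OF assms(5)] \<open>h \<le> T\<close>
  have "0 \<le> \<sigma> \<omega>" "\<sigma> \<omega> \<le> T" "0 \<le> \<tau> \<omega>" by force+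
  from payoff_bounds[OF elim(1) r_nonneg[OF \<open>0 < y\<close>] b_nonneg b_le_a m_nonneg this]
  show ?case by (simp add: reward_def)
qed

lemma integrable_payoff:
  assumes "0 < y" "0 \<le> h" "h \<le> T" "\<sigma> \<in> S h" "\<tau> \<in> S h"
  shows "integrable Q (\<lambda>\<omega>. payoff a b m h (\<lambda>u. r y u \<omega>) (\<sigma> \<omega>) (\<tau> \<omega>))"
proof (rule Bochner_Integration.integrable_bound)
  show "integrable Q (\<lambda>\<omega>. a + reward y 0 T \<omega>)"
    using integrable_reward[of y 0 T] assms T_nonneg by simp
  show "AE \<omega> in Q. norm (payoff a b m h (\<lambda>u. r y u \<omega>) (\<sigma> \<omega>) (\<tau> \<omega>)) \<le> norm (a + reward y 0 T \<omega>)"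
    using AE_payoff_bounds[OF assms] by eventually_elim auto
qed (rule payoff_measurable[OF assms(1,4,5)])

lemma mean_payoff_bounds:
  assumes "0 < y" "0 \<le> h" "h \<le> T" "\<sigma> \<in> S h" "\<tau> \<in> S h"
  shows "0 \<le> mean_payoff h y \<sigma> \<tau>" "mean_payoff h y \<sigma> \<tau> \<le> a + expectation (reward y 0 T)"
proof -
  show "0 \<le> mean_payoff h y \<sigma> \<tau>"
    unfolding mean_payoff_def using AE_payoff_bounds[OF assms]
    by (intro integral_nonneg_AE) (auto elim: eventually_mono)
  have int: "integrable Q (reward y 0 T)"
    using assms T_nonneg by (auto intro: integrable_reward)
  have "mean_payoff h y \<sigma> \<tau> \<le> expectation (\<lambda>\<omega>. a + reward y 0 T \<omega>)"
    unfolding mean_payoff_def using AE_payoff_bounds[OF assms] int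
    by (intro integral_mono_AE integrable_payoff[OF assms]) (auto elim: eventually_mono)
  also have "\<dots> = a + expectation (reward y 0 T)"
    using int by (simp add: prob_space)
  finally show "mean_payoff h y \<sigma> \<tau> \<le> a + expectation (reward y 0 T)" .
qed

lemma mean_payoff_lengthen:
  assumes y: "0 < y" and h: "0 \<le> h" "h \<le> h'" "h' \<le> T" and \<sigma>: "\<sigma> \<in> S h" and \<tau>: "\<tau> \<in> S h'"
  shows "mean_payoff h' y (\<lambda>\<omega>. if \<sigma> \<omega> < h then \<sigma> \<omega> else h') \<tau>
           \<le> mean_payoff h y \<sigma> (\<lambda>\<omega>. min (\<tau> \<omega>) h) + L y * (h' - h)"
proof -
  have hT: "h \<le> T" and h': "0 \<le> h'" using h by auto
  have int: "integrable Q (\<lambda>\<omega>. payoff a b m h (\<lambda>u. r y u \<omega>) (\<sigma> \<omega>) (min (\<tau> \<omega>) h))"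
    by (rule integrable_payoff[OF y h(1) hT \<sigma> S_truncate[OF h(1) \<tau>]])
  have int_window: "integrable Q (reward y h h')"
    using y h by (rule integrable_reward)
  have "mean_payoff h' y (\<lambda>\<omega>. if \<sigma> \<omega> < h then \<sigma> \<omega> else h') \<tau>
      \<le> expectation (\<lambda>\<omega>. payoff a b m h (\<lambda>u. r y u \<omega>) (\<sigma> \<omega>) (min (\<tau> \<omega>) h) + reward y h h' \<omega>)"
    unfolding mean_payoff_def
  proof (rule integral_mono_AE)
    show "integrable Q (\<lambda>\<omega>. payoff a b m h' (\<lambda>u. r y u \<omega>) (if \<sigma> \<omega> < h then \<sigma> \<omega> else h') (\<tau> \<omega>))"
      by (rule integrable_payoff[OF y h' h(3) S_extend[OF h(2) \<sigma>] \<tau>])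
    show "integrable Q (\<lambda>\<omega>. payoff a b m h (\<lambda>u. r y u \<omega>) (\<sigma> \<omega>) (min (\<tau> \<omega>) h) + reward y h h' \<omega>)"
      using int int_window by simp
    show "AE \<omega> in Q. payoff a b m h' (\<lambda>u. r y u \<omega>) (if \<sigma> \<omega> < h then \<sigma> \<omega> else h') (\<tau> \<omega>)
        \<le> payoff a b m h (\<lambda>u. r y u \<omega>) (\<sigma> \<omega>) (min (\<tau> \<omega>) h) + reward y h h' \<omega>"
      using AE_integrable_reward[OF y] AE_space
    proof eventually_elim
      case (elim \<omega>)
      with S_range[OF \<sigma>] S_range[OF \<tau>] show ?case
        unfolding reward_def
        by (intro payoff_lengthen[OF elim(1)] r_nonneg y b_nonneg m_nonneg h) auto
    qed
  qed
  also have "\<dots> = mean_payoff h y \<sigma> (\<lambda>\<omega>. min (\<tau> \<omega>) h) + expectation (reward y h h')"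
    unfolding mean_payoff_def using int int_window by (rule Bochner_Integration.integral_add)
  finally show ?thesis using mean_reward_le[OF y h] by simp
qed

lemma mean_payoff_shorten:
  assumes y: "0 < y" and h: "0 \<le> h" "h \<le> h'" "h' \<le> T" and \<sigma>: "\<sigma> \<in> S h'" and \<tau>: "\<tau> \<in> S h"
  shows "mean_payoff h y (\<lambda>\<omega>. min (\<sigma> \<omega>) h) \<tau> \<le> mean_payoff h' y \<sigma> \<tau>"
  unfolding mean_payoff_def
proof (rule integral_mono_AE)
  have hT: "h \<le> T" and h': "0 \<le> h'" using h by auto
  show "integrable Q (\<lambda>\<omega>. payoff a b m h (\<lambda>u. r y u \<omega>) (min (\<sigma> \<omega>) h) (\<tau> \<omega>))"
    by (rule integrable_payoff[OF y h(1) hT S_truncate[OF h(1) \<sigma>] \<tau>])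
  show "integrable Q (\<lambda>\<omega>. payoff a b m h' (\<lambda>u. r y u \<omega>) (\<sigma> \<omega>) (\<tau> \<omega>))"
    by (rule integrable_payoff[OF y h' h(3) \<sigma>]) (use \<tau> S_mono[OF h(2)] in auto)
  show "AE \<omega> in Q. payoff a b m h (\<lambda>u. r y u \<omega>) (min (\<sigma> \<omega>) h) (\<tau> \<omega>)
      \<le> payoff a b m h' (\<lambda>u. r y u \<omega>) (\<sigma> \<omega>) (\<tau> \<omega>)"
    using S_range[OF \<sigma>] S_range[OF \<tau>] by (intro AE_I2 payoff_shorten b_le_a h) auto
qed

lemma mean_payoff_change_state:
  assumes y: "0 < y" "0 < y'" and h: "0 \<le> h" "h \<le> T" and \<sigma>: "\<sigma> \<in> S h" and \<tau>: "\<tau> \<in> S h"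
  shows "mean_payoff h y \<sigma> \<tau>
           \<le> mean_payoff h y' \<sigma> \<tau> + \<bar>expectation (reward y 0 T) - expectation (reward y' 0 T)\<bar>"
proof -
  let ?D = "\<lambda>\<omega>. LBINT u:{0..T}. \<bar>r y u \<omega> - r y' u \<omega>\<bar>"
  note int = integrable_payoff[OF y(1) h \<sigma> \<tau>] integrable_payoff[OF y(2) h \<sigma> \<tau>] mean_reward_diff(1)[OF y]
  have "mean_payoff h y \<sigma> \<tau>
      \<le> expectation (\<lambda>\<omega>. payoff a b m h (\<lambda>u. r y' u \<omega>) (\<sigma> \<omega>) (\<tau> \<omega>) + ?D \<omega>)"
    unfolding mean_payoff_def
  proof (rule integral_mono_AE)
    show "AE \<omega> in Q. payoff a b m h (\<lambda>u. r y u \<omega>) (\<sigma> \<omega>) (\<tau> \<omega>)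
        \<le> payoff a b m h (\<lambda>u. r y' u \<omega>) (\<sigma> \<omega>) (\<tau> \<omega>) + ?D \<omega>"
      using AE_integrable_reward[OF y(1)] AE_integrable_reward[OF y(2)] AE_space
    proof eventually_elim
      case (elim \<omega>)
      with S_range[OF \<sigma>] h show ?case
        by (intro payoff_change_reward[OF elim(1,2)]) force
    qed
  qed (use int in simp_all)
  also have "\<dots> = mean_payoff h y' \<sigma> \<tau> + expectation ?D"
    unfolding mean_payoff_def using int(2,3) by (rule Bochner_Integration.integral_add)
  finally show ?thesis by (simp add: mean_reward_diff(2)[OF y])
qed

definition upper :: "real \<Rightarrow> real \<Rightarrow> real" where
  "upper h y = (INF \<sigma>\<in>S h. SUP \<tau>\<in>S h. mean_payoff h y \<sigma> \<tau>)"

definition lower :: "real \<Rightarrow> real \<Rightarrow> real" where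
  "lower h y = (SUP \<tau>\<in>S h. INF \<sigma>\<in>S h. mean_payoff h y \<sigma> \<tau>)"

text \<open>
  Applied with postponement, truncation and the identity as translations \<open>f\<close> and \<open>g\<close>, this turns
  the three comparisons of payoffs into comparisons of values.
\<close>
lemma values_transfer:
  assumes "0 < y" "0 < y'" "0 \<le> h" "h \<le> T" "0 \<le> h'" "h' \<le> T"
    and "\<And>\<sigma>. \<sigma> \<in> S h \<Longrightarrow> f \<sigma> \<in> S h'" "\<And>\<tau>. \<tau> \<in> S h' \<Longrightarrow> g \<tau> \<in> S h"
    and "\<And>\<sigma> \<tau>. \<sigma> \<in> S h \<Longrightarrow> \<tau> \<in> S h' \<Longrightarrow> mean_payoff h' y' (f \<sigma>) \<tau> \<le> mean_payoff h y \<sigma> (g \<tau>) + e"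
  shows "upper h' y' \<le> upper h y + e" "lower h' y' \<le> lower h y + e"
  unfolding upper_def lower_def
  using assms by (auto intro!: INF_SUP_transfer[where f = f and g = g] SUP_INF_transfer[where f = f and g = g]
      mean_payoff_bounds S_nonempty)

lemma values_lengthen:
  assumes "0 < y" "0 \<le> h" "h \<le> h'" "h' \<le> T"
  shows "upper h' y \<le> upper h y + L y * (h' - h)" "lower h' y \<le> lower h y + L y * (h' - h)"
proof -
  have "h \<le> T" "0 \<le> h'" using assms by auto
  note transfer = values_transfer[OF assms(1) assms(1,2) this assms(4) S_extend[OF assms(3)]
      S_truncate[OF assms(2)] mean_payoff_lengthen[OF assms]]
  show "upper h' y \<le> upper h y + L y * (h' - h)" "lower h' y \<le> lower h y + L y * (h' - h)"
    by (rule transfer; assumption)+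
qed

lemma values_shorten:
  assumes "0 < y" "0 \<le> h" "h \<le> h'" "h' \<le> T"
  shows "upper h y \<le> upper h' y" "lower h y \<le> lower h' y"
  using assms S_truncate S_mono[OF assms(3)] mean_payoff_shorten[OF assms]
    values_transfer[of y y h' h "\<lambda>\<sigma> \<omega>. min (\<sigma> \<omega>) h" "\<lambda>\<tau>. \<tau>" 0]
  by (simp_all add: subset_iff)

lemma values_change_state:
  assumes "0 < y" "0 < y'" "0 \<le> h" "h \<le> T"
  shows "upper h y \<le> upper h y' + \<bar>expectation (reward y 0 T) - expectation (reward y' 0 T)\<bar>"
    "lower h y \<le> lower h y' + \<bar>expectation (reward y 0 T) - expectation (reward y' 0 T)\<bar>"
  using assms values_transfer[of y' y h h "\<lambda>\<sigma>. \<sigma>" "\<lambda>\<tau>. \<tau>"] mean_payoff_change_state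
  by auto

text \<open>
  The values are Lipschitz in the horizon on \<open>[0,T]\<close> because the maximal gain from
  a longer game is the mean reward of the extra time; in the state they vary no more than the mean of
  the whole running reward.
\<close>
lemma value_modulus:
  assumes V: "V = upper \<or> V = lower"
    and y: "0 < y" "0 < y0" and h: "0 \<le> h" "h \<le> T" "0 \<le> h0" "h0 \<le> T"
  shows "\<bar>V h y - V h0 y0\<bar> \<le>
    \<bar>expectation (reward y 0 T) - expectation (reward y0 0 T)\<bar> + L y0 * \<bar>h - h0\<bar>"
proof -
  have "V h y \<le> V h y0 + \<bar>expectation (reward y 0 T) - expectation (reward y0 0 T)\<bar>"
    "V h y0 \<le> V h y + \<bar>expectation (reward y0 0 T) - expectation (reward y 0 T)\<bar>"
    using V values_change_state y h by auto
  moreover have "\<bar>V h y0 - V h0 y0\<bar> \<le> L y0 * \<bar>h - h0\<bar>"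
  proof (cases "h \<le> h0")
    case True
    then have "V h y0 \<le> V h0 y0" "V h0 y0 \<le> V h y0 + L y0 * (h0 - h)"
      using V values_lengthen[OF y(2) h(1) _ h(4)] values_shorten[OF y(2) h(1) _ h(4)] by auto
    with True show ?thesis by simp
  next
    case False
    then have "V h0 y0 \<le> V h y0" "V h y0 \<le> V h0 y0 + L y0 * (h - h0)"
      using V values_lengthen[OF y(2) h(3) _ h(2)] values_shorten[OF y(2) h(3) _ h(2)] by auto
    with False show ?thesis by simp
  qed
  ultimately show ?thesis by linarith
qed

lemma continuous_value:
  assumes V: "V = upper \<or> V = lower"
  shows "continuous_on ({0..T} \<times> {0<..}) (\<lambda>(t, y). V (T - t) y)"
  unfolding continuous_on_def
proof (rule ballI)
  fix p :: "real \<times> real" assume "p \<in> {0..T} \<times> {0::real<..}"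
  then obtain t0 y0 where p: "p = (t0, y0)" and t0: "0 \<le> t0" "t0 \<le> T" and y0: "0 < y0"
    by (cases p) auto
  let ?F = "at p within {0..T} \<times> {0<..}" and ?\<Phi> = "\<lambda>y. expectation (reward y 0 T)"
  have "continuous_on ({0..T} \<times> {0<..}) (\<lambda>p. ?\<Phi> (snd p))"
    by (intro continuous_on_compose2[OF continuous_mean_reward] continuous_intros) auto
  then have "((\<lambda>q. ?\<Phi> (snd q)) \<longlongrightarrow> ?\<Phi> (snd p)) ?F"
    using t0 y0 unfolding p continuous_on_def by auto
  moreover have "((\<lambda>q. fst q) \<longlongrightarrow> fst p) ?F"
    by (intro tendsto_intros)
  ultimately have "((\<lambda>q. \<bar>?\<Phi> (snd q) - ?\<Phi> (snd p)\<bar> + L y0 * \<bar>fst p - fst q\<bar>)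
      \<longlongrightarrow> \<bar>?\<Phi> (snd p) - ?\<Phi> (snd p)\<bar> + L y0 * \<bar>fst p - fst p\<bar>) ?F"
    by (intro tendsto_intros)
  then have lim: "((\<lambda>q. \<bar>?\<Phi> (snd q) - ?\<Phi> (snd p)\<bar> + L y0 * \<bar>fst p - fst q\<bar>) \<longlongrightarrow> 0) ?F"
    by simp
  show "((\<lambda>(t, y). V (T - t) y) \<longlongrightarrow> (case p of (t, y) \<Rightarrow> V (T - t) y)) ?F"
  proof (rule LIM_zero_cancel, rule Lim_null_comparison[OF _ lim])
    show "\<forall>\<^sub>F q in ?F. norm ((case q of (t, y) \<Rightarrow> V (T - t) y) - (case p of (t, y) \<Rightarrow> V (T - t) y))
        \<le> \<bar>?\<Phi> (snd q) - ?\<Phi> (snd p)\<bar> + L y0 * \<bar>fst p - fst q\<bar>"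
      unfolding eventually_at_filter
    proof (intro always_eventually allI impI)
      fix q assume "q \<in> {0..T} \<times> {0::real<..}"
      then show "norm ((case q of (t, y) \<Rightarrow> V (T - t) y) - (case p of (t, y) \<Rightarrow> V (T - t) y))
          \<le> \<bar>?\<Phi> (snd q) - ?\<Phi> (snd p)\<bar> + L y0 * \<bar>fst p - fst q\<bar>"
        using value_modulus[OF V, of "snd q" y0 "T - fst q" "T - t0"] t0 y0
        by (auto simp: p)
    qed
  qed
qed

end

section \<open>Continuity of the value functions\<close>

theorem theorem3p4:
  fixes M Q :: "'a measure" and W :: "real \<Rightarrow> 'a \<Rightarrow> real"
    and T muC sigC fC muF cp cm G0 :: real
    and R G :: "real \<Rightarrow> real"
  assumes "T > 0" "muC > 0" "sigC > 0" "fC > 0" "muF > 0" "cp > cm" "cm > 0"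
    and "prob_space M" "complete_measure M"
    and "brownian_motion M W"
    and "tilde_measure M W T sigC Q"
    and R_meas: "R \<in> borel_measurable (restrict_space borel {0..})"
    and R_nonneg: "\<And>C. C \<ge> 0 \<Longrightarrow> R C \<ge> 0"
    and R_mono: "mono_on {0..} R"
    and R_concave: "strictly_concave_on {0..} R"
    and R_zero: "R 0 = 0"
    and R_C1: "\<And>C. C > 0 \<Longrightarrow> R differentiable at C"
    and R_C2: "\<And>C. C > 0 \<Longrightarrow> deriv R differentiable at C"
    and R_C2_cont: "continuous_on {0<..} (deriv (deriv R))"
    and Rc_zero: "filterlim (deriv R) at_top (at_right 0)"
    and Rc_infinity: "(deriv R \<longlongrightarrow> 0) at_top"
    and G0: "G0 \<ge> 0"
    and G: "\<And>C. C \<ge> 0 \<Longrightarrow> G C = G0 + cm / fC * C"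
  shows "continuous_on ({0..T} \<times> {0<..})
           (\<lambda>(t, y). upper_value M Q W T muC sigC fC muF cp cm (deriv R) (deriv G) t y) \<and>
         continuous_on ({0..T} \<times> {0<..})
           (\<lambda>(t, y). lower_value M Q W T muC sigC fC muF cp cm (deriv R) (deriv G) t y)"
proof -
  interpret M: complete_measure M by fact
  have W: "\<And>t. 0 \<le> t \<Longrightarrow> W t \<in> borel_measurable M"
    using \<open>brownian_motion M W\<close> by (simp add: brownian_motion_def)
  have Q: "prob_space Q" and space_Q [simp]: "space Q = space M" and sets_Q: "sets Q = sets M"
    using \<open>tilde_measure M W T sigC Q\<close> by (auto simp: tilde_measure_def)
  have measurable_Q: "f \<in> borel_measurable Q \<longleftrightarrow> f \<in> borel_measurable M" for f :: "'a \<Rightarrow> real"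
    by (rule measurable_cong_sets[OF sets_Q refl, THEN arg_cong])
  obtain X N where N: "N \<in> null_sets M" and X: "\<And>t. X t \<in> borel_measurable M"
    and X_cont: "\<And>\<omega>. continuous_on UNIV (\<lambda>t. X t \<omega>)"
    and X_eq: "\<And>\<omega> t. \<omega> \<in> space M - N \<Longrightarrow> 0 \<le> t \<Longrightarrow> X t \<omega> = W t \<omega>"
    by (rule ex_continuous_modification[OF \<open>brownian_motion M W\<close>]) blast
  have N_Q: "N \<in> null_sets Q"
    using null_sets_tilde_measure[OF \<open>tilde_measure M W T sigC Q\<close> _ W N] \<open>T > 0\<close> by simp
  have off_N: "AE \<omega> in Q. \<omega> \<in> space M - N"
    using AE_not_in[OF N_Q] AE_space[of Q] by eventually_elim simp
  have C0_eq: "C0 X muC sigC t \<omega> = C0 W muC sigC t \<omega>" if "\<omega> \<in> space M - N" "0 \<le> t" for t \<omega>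
    using X_eq[OF that] by (simp add: C0_def)

  \<comment> \<open>The data of the abstract game; \<open>L\<close> combines \<open>R'(x) \<le> R'(1) + R(1) / x\<close> with the mean of \<open>1 / C0\<close>.\<close>
  define m where "m = muC + muF"
  define r where "r y u \<omega> = exp (- m * u) * deriv R (y * C0 X muC sigC u \<omega>)" for y u \<omega>
  define L where "L y = deriv R 1 + R 1 / y * exp (muC * T)" for y
  have R1: "0 \<le> R 1" "0 \<le> deriv R 1"
    using R_nonneg[of 1] concave_deriv_bounds(1)[OF R_concave R_C1 R_mono R_zero, of 1] by auto
  have deriv_R_cont: "isCont (deriv R) x" if "0 < x" for x
    using R_C2[OF that] by (rule differentiable_imp_continuous_within)
  interpret game: stopping_game Q T "cp / fC" "cm / fC" m r L "stopping_times M W"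
  proof (intro stopping_game.intro stopping_game_axioms.intro Q)
    show "0 \<le> cm / fC" "cm / fC \<le> cp / fC" "0 \<le> m" "0 \<le> T"
      using assms(1-7) by (auto simp: m_def divide_right_mono)
  next
    fix y :: real assume y: "0 < y"
    \<comment> \<open>In logarithmic coordinates the marginal reward is continuous on the whole line.\<close>
    have "continuous_on UNIV (\<lambda>x. deriv R (exp x))"
      by (intro continuous_at_imp_continuous_on ballI isCont_o2[OF isCont_exp] deriv_R_cont) simp
    then have [measurable]: "(\<lambda>x. deriv R (exp x)) \<in> borel_measurable borel"
      by (rule borel_measurable_continuous_onI)
    have [measurable]: "(\<lambda>(\<omega>, u). X u \<omega>) \<in> borel_measurable (Q \<Otimes>\<^sub>M lborel)"
      using X X_cont by (intro measurable_continuous_process) (simp_all add: measurable_Q)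
    have "r y u \<omega> = exp (- m * u) * (\<lambda>x. deriv R (exp x))
        (ln y + ((- muC + (1/2) * sigC\<^sup>2) * u + sigC * (X u \<omega> - sigC * u)))" for u \<omega>
      unfolding r_def C0_def Let_def using y by (simp add: exp_add[of "ln y"])
    then show "(\<lambda>(\<omega>, u). r y u \<omega>) \<in> borel_measurable (Q \<Otimes>\<^sub>M lborel)"
      by simp
    show "0 \<le> r y u \<omega>" for u \<omega>
      unfolding r_def using y C0_pos[of X]
      by (intro mult_nonneg_nonneg concave_deriv_bounds(1)[OF R_concave R_C1 R_mono R_zero]) auto
    show "r y' u \<omega> \<le> r y u \<omega>" if "y \<le> y'" for y' u \<omega>
      unfolding r_def using y that C0_pos[of X muC sigC u \<omega>]
      by (intro mult_left_mono concave_deriv_antimono[OF R_concave R_C1] mult_right_mono) auto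
    show "isCont (\<lambda>y. r y u \<omega>) y" for u \<omega>
    proof -
      have "isCont (\<lambda>y. y * C0 X muC sigC u \<omega>) y"
        by (intro continuous_intros)
      moreover have "isCont (deriv R) (y * C0 X muC sigC u \<omega>)"
        using y C0_pos by (intro deriv_R_cont mult_pos_pos)
      ultimately have "isCont (\<lambda>y. deriv R (y * C0 X muC sigC u \<omega>)) y"
        by (rule isCont_o2)
      then show ?thesis
        unfolding r_def by (intro continuous_mult continuous_const)
    qed
    show "0 \<le> L y"
      unfolding L_def using R1 y by simp
    show "(\<integral>\<^sup>+\<omega>. ennreal (r y u \<omega>) \<partial>Q) \<le> ennreal (L y)" if u: "0 \<le> u" "u \<le> T" for u
    proof -
      have X_meas: "(\<lambda>\<omega>. 1 / C0 X muC sigC u \<omega>) \<in> borel_measurable Q"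
        unfolding measurable_Q C0_def Let_def using X by measurable
      have "(\<integral>\<^sup>+\<omega>. ennreal (r y u \<omega>) \<partial>Q) \<le>
          (\<integral>\<^sup>+\<omega>. ennreal (deriv R 1) + ennreal (R 1 / y) * ennreal (1 / C0 X muC sigC u \<omega>) \<partial>Q)"
      proof (intro nn_integral_mono)
        fix \<omega>
        have C: "0 < y * C0 X muC sigC u \<omega>" using y C0_pos by (rule mult_pos_pos)
        have "0 \<le> m" using \<open>muC > 0\<close> \<open>muF > 0\<close> by (simp add: m_def)
        then have "r y u \<omega> \<le> 1 * deriv R (y * C0 X muC sigC u \<omega>)"
          unfolding r_def using u concave_deriv_bounds(1)[OF R_concave R_C1 R_mono R_zero C]
          by (intro mult_right_mono) auto
        also have "\<dots> \<le> deriv R 1 + R 1 / y * (1 / C0 X muC sigC u \<omega>)"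
          using concave_deriv_bounds(2)[OF R_concave R_C1 R_mono R_zero C] by simp
        finally show "ennreal (r y u \<omega>)
            \<le> ennreal (deriv R 1) + ennreal (R 1 / y) * ennreal (1 / C0 X muC sigC u \<omega>)"
          using R1 y C0_pos[of X muC sigC u \<omega>]
          by (simp add: ennreal_mult[symmetric] ennreal_plus[symmetric] del: ennreal_plus)
      qed
      also have "\<dots> = ennreal (deriv R 1) + ennreal (R 1 / y) *
          (\<integral>\<^sup>+\<omega>. ennreal (1 / C0 X muC sigC u \<omega>) \<partial>Q)"
        using X_meas prob_space.emeasure_space_1[OF Q]
        by (simp add: nn_integral_add nn_integral_cmult)
      also have "(\<integral>\<^sup>+\<omega>. ennreal (1 / C0 X muC sigC u \<omega>) \<partial>Q) = (\<integral>\<^sup>+\<omega>. ennreal (1 / C0 W muC sigC u \<omega>) \<partial>Q)"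
        by (rule nn_integral_cong_AE, use off_N in eventually_elim) (simp only: C0_eq u)
      also have "\<dots> = ennreal (exp (muC * u))"
        using \<open>tilde_measure M W T sigC Q\<close> \<open>prob_space M\<close> W u by (rule nn_integral_inverse_C0)
      also have "ennreal (deriv R 1) + ennreal (R 1 / y) * \<dots> \<le> ennreal (L y)"
        using R1 y u \<open>muC > 0\<close>
        by (auto simp: L_def ennreal_mult[symmetric] ennreal_plus[symmetric] intro!: mult_left_mono divide_right_mono
            simp del: ennreal_plus)
      finally show ?thesis .
    qed
  next
    fix h h' :: real and \<tau> :: "'a \<Rightarrow> real"
    show "\<tau> \<in> stopping_times M W h \<Longrightarrow> \<tau> \<in> borel_measurable Q"
      unfolding measurable_Q by (rule stopping_times_measurable[OF W])
    show "\<tau> \<in> stopping_times M W h \<Longrightarrow> \<omega> \<in> space Q \<Longrightarrow> 0 \<le> \<tau> \<omega> \<and> \<tau> \<omega> \<le> h" for \<omega>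
      by (auto simp: stopping_times_def)
    show "0 \<le> h \<Longrightarrow> stopping_times M W h \<noteq> {}"
      using stopping_times_zero by blast
    show "h \<le> h' \<Longrightarrow> stopping_times M W h \<subseteq> stopping_times M W h'"
      by (rule stopping_times_mono)
    show "0 \<le> h \<Longrightarrow> \<tau> \<in> stopping_times M W h' \<Longrightarrow> (\<lambda>\<omega>. min (\<tau> \<omega>) h) \<in> stopping_times M W h"
      by (rule stopping_times_truncate)
    show "h \<le> h' \<Longrightarrow> \<tau> \<in> stopping_times M W h \<Longrightarrow>
        (\<lambda>\<omega>. if \<tau> \<omega> < h then \<tau> \<omega> else h') \<in> stopping_times M W h'"
      by (rule stopping_times_extend)
  qed

  have deriv_G: "deriv G x = cm / fC" if "0 < x" for x
  proof -
    have "((\<lambda>x. G0 + cm / fC * x) has_real_derivative cm / fC) (at x)"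
      using \<open>fC > 0\<close> by (auto intro!: derivative_eq_intros)
    then have "(G has_real_derivative cm / fC) (at x)"
      by (rule has_field_derivative_transform_within_open[where S = "{0<..}"]) (use that G in auto)
    then show ?thesis by (rule DERIV_imp_deriv)
  qed
  have Psi_eq: "Psi Q W T muC sigC fC muF cp cm (deriv R) (deriv G) t y \<sigma> \<tau> = game.mean_payoff (T - t) y \<sigma> \<tau>"
    if t: "t \<in> {0..T}" and y: "0 < y"
      and \<sigma>: "\<sigma> \<in> stopping_times M W (T - t)" and \<tau>: "\<tau> \<in> stopping_times M W (T - t)" for t y \<sigma> \<tau>
  proof -
    define f where "f \<omega> = cp / fC * exp (- m * \<sigma> \<omega>) * of_bool (\<sigma> \<omega> \<le> \<tau> \<omega>) * of_bool (\<sigma> \<omega> < T - t)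
         + cm / fC * exp (- m * \<tau> \<omega>) * of_bool (\<tau> \<omega> < \<sigma> \<omega>)
         + exp (- m * (T - t)) * deriv G (y * C0 W muC sigC (T - t) \<omega>)
             * of_bool (\<tau> \<omega> = T - t \<and> \<sigma> \<omega> = T - t)
         + (LBINT s:{0..min (\<tau> \<omega>) (\<sigma> \<omega>)}. exp (- m * s) * deriv R (y * C0 W muC sigC s \<omega>))" for \<omega>
    define g where "g \<omega> = payoff (cp / fC) (cm / fC) m (T - t) (\<lambda>u. r y u \<omega>) (\<sigma> \<omega>) (\<tau> \<omega>)" for \<omega>
    have fg: "f \<omega> = g \<omega>" if \<omega>: "\<omega> \<in> space M - N" for \<omega>
    proof -
      have "(LBINT s:{0..min (\<tau> \<omega>) (\<sigma> \<omega>)}. exp (- m * s) * deriv R (y * C0 W muC sigC s \<omega>)) =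
          (LBINT s:{0..min (\<tau> \<omega>) (\<sigma> \<omega>)}. r y s \<omega>)"
        using C0_eq[OF \<omega>] by (intro set_lebesgue_integral_cong) (auto simp: r_def)
      moreover have "0 \<le> \<sigma> \<omega>" "\<sigma> \<omega> \<le> T - t" "0 \<le> \<tau> \<omega>" "\<tau> \<omega> \<le> T - t"
        using \<sigma> \<tau> \<omega> by (auto simp: stopping_times_def)
      ultimately show ?thesis
        unfolding f_def g_def using y C0_pos[of W]
        by (simp only: deriv_G mult_pos_pos payoff_alt)
    qed
    have g_meas: "g \<in> borel_measurable Q"
      unfolding g_def[abs_def] using y \<sigma> \<tau> by (rule game.payoff_measurable)
    \<comment> \<open>The original integrand agrees with a measurable one off a null set, which suffices as \<open>M\<close> is complete.\<close>
    have f_meas: "f \<in> borel_measurable Q"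
      using M.borel_measurable_modification[OF _ N fg] g_meas by (simp add: measurable_Q)
    have "(\<integral>\<omega>. f \<omega> \<partial>Q) = (\<integral>\<omega>. g \<omega> \<partial>Q)"
      by (rule integral_cong_AE[OF f_meas g_meas], use off_N in eventually_elim) (rule fg)
    then show ?thesis
      unfolding Psi_def game.mean_payoff_def Let_def m_def[symmetric] f_def g_def .
  qed
  have values_eq:
    "upper_value M Q W T muC sigC fC muF cp cm (deriv R) (deriv G) t y = game.upper (T - t) y"
    "lower_value M Q W T muC sigC fC muF cp cm (deriv R) (deriv G) t y = game.lower (T - t) y"
    if "t \<in> {0..T}" "0 < y" for t y
    unfolding upper_value_def lower_value_def game.upper_def game.lower_def
    using that by (auto intro!: INF_cong SUP_cong simp: Psi_eq)
  show ?thesis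
  proof
    show "continuous_on ({0..T} \<times> {0<..})
        (\<lambda>(t, y). upper_value M Q W T muC sigC fC muF cp cm (deriv R) (deriv G) t y)"
      by (rule continuous_on_eq[OF game.continuous_value[of game.upper]]) (auto simp: values_eq)
    show "continuous_on ({0..T} \<times> {0<..})
        (\<lambda>(t, y). lower_value M Q W T muC sigC fC muF cp cm (deriv R) (deriv G) t y)"
      by (rule continuous_on_eq[OF game.continuous_value[of game.lower]]) (auto simp: values_eq)
  qed
qed

end
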